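(* Let $K\subset\mathbb{R}$ be Borel-measurable. Then the h-metric space $\langle\mathcal{L}_{\mathrm{H}}(K),d\rangle$, where $d(f,g)=(\mathrm{H})\int_K|f-g|$, is complete.
   Context: On $[0,+\infty)\times[0,+\infty]$ use the lexicographic order: $(d_1,m_1)\leq(d_2,m_2)$ iff $d_1<d_2$, or $d_1=d_2$ and $m_1\leq m_2$; and the sum $(d_1,m_1)+(d_2,m_2)$ equal to $(d_2,m_2)$ if $d_1<d_2$, to $(d_1,m_1)$ if $d_2<d_1$, and to $(d_1,m_1+m_2)$ if $d_1=d_2$. An h-metric on a set $X$ is a map $d:X\times X\to[0,+\infty)\times[0,+\infty]$ such that for all $x,y,z\in X$: (1) $d(x,y)=(0,0)$ iff $x=y$; (2) $d(x,y)=d(y,x)$; (3) $d(x,z)\leq d(x,y)+d(y,z)$. Then $\langle X,d\rangle$ is called an h-metric space. Its topology is the one in which the basic neighborhoods of $x\in X$ are the sets $S(x,(\varepsilon_1,\varepsilon_2))=\{y\in X:d(x,y)<(\varepsilon_1,\varepsilon_2)\}$ with $(\varepsilon_1,\varepsilon_2)>(0,0)$. A sequence $(x_n)$ in $X$ is a Cauchy-sequence if for all $(\varepsilon_1,\varepsilon_2)>(0,0)$ there is $N\in\mathbb{N}$ such that $n,m>N$ implies $d(x_n,x_m)<(\varepsilon_1,\varepsilon_2)$. The space is complete if every Cauchy-sequence is convergent (in this topology, to a point of $X$). $\dim_{\mathrm{H}}$ denotes Hausdorff dimension and $\mu^d$ the $d$-dimensional Hausdorff measure on $\mathbb{R}$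 (normalized so that $\mu^0$ is the counting measure and $\mu^1$ is the Lebesgue measure). Hausdorff-integral: for $K\subset\mathbb{R}$ Borel-measurable and $f:K\to\mathbb{R}$ Borel-measurable, let $D_f=\{x\in K: f(x)\neq 0\}$ and set $(\mathrm{H})\int_K f=(d,m)\in[0,1]\times[-\infty,+\infty]$, where $d=\dim_{\mathrm{H}}D_f$ and $m=\int_{D_f}f\,d\mu^d$, with the conventions $\dim_{\mathrm{H}}\emptyset=0$ and $\int_\emptyset f\,d\mu^d=0$. The function $f$ is Hausdorff-integrable if its Hausdorff-integral exists and $m\in\mathbb{R}$. For $f\ge 0$ the Hausdorff-integral always exists (possibly with $m=+\infty$). $\mathcal{L}_{\mathrm{H}}(K)$ is the set of Borel-measurable functions $f:K\to\mathbb{R}$ such that $|f|$ is Hausdorff-integrable. The map $d(f,g)=(\mathrm{H})\int_K|f-g|$ is an h-metric on $\mathcal{L}_{\mathrm{H}}(K)$. *)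

theory Defs
  imports "HOL-Analysis.Analysis"
begin

section \<open>h-metric spaces\<close>

text \<open>
  The value domain \<open>[0,\<infinity>) \<times> [0,\<infinity>]\<close> is a subset of \<open>real \<times> ereal\<close>. The lexicographic order is not
  introduced as an instance of the order classes, since HOL-Analysis already orders pairs componentwise.
\<close>

definition hvals :: "(real \<times> ereal) set" where
  "hvals = {0..} \<times> {0..}"

definition lex_less :: "real \<times> ereal \<Rightarrow> real \<times> ereal \<Rightarrow> bool" (infix "\<prec>" 50) where
  "p \<prec> q \<longleftrightarrow> fst p < fst q \<or> (fst p = fst q \<and> snd p < snd q)"

definition lex_le :: "real \<times> ereal \<Rightarrow> real \<times> ereal \<Rightarrow> bool" (infix "\<preceq>" 50) where
  "p \<preceq> q \<longleftrightarrow> fst p < fst q \<or> (fst p = fst q \<and> snd p \<le> snd q)"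

definition h_plus :: "real \<times> ereal \<Rightarrow> real \<times> ereal \<Rightarrow> real \<times> ereal" (infixl "+\<^sub>h" 65) where
  "p +\<^sub>h q = (if fst p < fst q then q else if fst q < fst p then p else (fst p, snd p + snd q))"

definition h_metric_space :: "'a set \<Rightarrow> ('a \<Rightarrow> 'a \<Rightarrow> real \<times> ereal) \<Rightarrow> bool" where
  "h_metric_space X d \<longleftrightarrow>
     (\<forall>x\<in>X. \<forall>y\<in>X. d x y \<in> hvals) \<and>
     (\<forall>x\<in>X. \<forall>y\<in>X. d x y = (0, 0) \<longleftrightarrow> x = y) \<and>
     (\<forall>x\<in>X. \<forall>y\<in>X. d x y = d y x) \<and>
     (\<forall>x\<in>X. \<forall>y\<in>X. \<forall>z\<in>X. d x z \<preceq> d x y +\<^sub>h d y z)"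

definition h_ball :: "'a set \<Rightarrow> ('a \<Rightarrow> 'a \<Rightarrow> real \<times> ereal) \<Rightarrow> 'a \<Rightarrow> real \<times> ereal \<Rightarrow> 'a set" where
  "h_ball X d x e = {y \<in> X. d x y \<prec> e}"

definition h_topology :: "'a set \<Rightarrow> ('a \<Rightarrow> 'a \<Rightarrow> real \<times> ereal) \<Rightarrow> 'a topology" where
  "h_topology X d =
     topology (\<lambda>U. U \<subseteq> X \<and> (\<forall>x\<in>U. \<exists>e\<in>hvals. (0, 0) \<prec> e \<and> h_ball X d x e \<subseteq> U))"

definition h_Cauchy :: "('a \<Rightarrow> 'a \<Rightarrow> real \<times> ereal) \<Rightarrow> (nat \<Rightarrow> 'a) \<Rightarrow> bool" where
  "h_Cauchy d s \<longleftrightarrow>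
     (\<forall>e\<in>hvals. (0, 0) \<prec> e \<longrightarrow> (\<exists>N. \<forall>n m. n > N \<and> m > N \<longrightarrow> d (s n) (s m) \<prec> e))"

definition h_complete :: "'a set \<Rightarrow> ('a \<Rightarrow> 'a \<Rightarrow> real \<times> ereal) \<Rightarrow> bool" where
  "h_complete X d \<longleftrightarrow>
     (\<forall>s. range s \<subseteq> X \<and> h_Cauchy d s \<longrightarrow> (\<exists>x\<in>X. limitin (h_topology X d) s x sequentially))"

lemma lex_less_lex_cases: "lex_less p q \<or> p = q \<or> lex_less q p"
  by (cases p; cases q) (auto simp: lex_less_def)

lemma lex_less_trans: "lex_less p q \<Longrightarrow> lex_less q r \<Longrightarrow> lex_less p r"
  by (auto simp: lex_less_def)

lemma istopology_h_topology:
  "istopology (\<lambda>U. U \<subseteq> X \<and> (\<forall>x\<in>U. \<exists>e\<in>hvals. (0, 0) \<prec> e \<and> h_ball X d x e \<subseteq> U))"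
proof -
  have *: "\<exists>e\<in>hvals. (0, 0) \<prec> e \<and> h_ball X d x e \<subseteq> S \<inter> T"
    if "e1 \<in> hvals" "(0, 0) \<prec> e1" "h_ball X d x e1 \<subseteq> S"
       "e2 \<in> hvals" "(0, 0) \<prec> e2" "h_ball X d x e2 \<subseteq> T" for x e1 e2 S T
  proof -
    have "h_ball X d x e1 \<subseteq> h_ball X d x e2 \<or> h_ball X d x e2 \<subseteq> h_ball X d x e1"
      using lex_less_lex_cases[of e1 e2] by (auto simp: h_ball_def dest: lex_less_trans)
    with that show ?thesis by blast
  qed
  show ?thesis
    unfolding istopology_def
  proof (intro conjI allI impI)
    fix S T
    assume S: "S \<subseteq> X \<and> (\<forall>x\<in>S. \<exists>e\<in>hvals. (0, 0) \<prec> e \<and> h_ball X d x e \<subseteq> S)"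
      and T: "T \<subseteq> X \<and> (\<forall>x\<in>T. \<exists>e\<in>hvals. (0, 0) \<prec> e \<and> h_ball X d x e \<subseteq> T)"
    show "S \<inter> T \<subseteq> X" using S by blast
    show "\<forall>x\<in>S \<inter> T. \<exists>e\<in>hvals. (0, 0) \<prec> e \<and> h_ball X d x e \<subseteq> S \<inter> T"
    proof
      fix x assume x: "x \<in> S \<inter> T"
      obtain e1 where "e1 \<in> hvals" "(0, 0) \<prec> e1" "h_ball X d x e1 \<subseteq> S" using S x by blast
      moreover obtain e2 where "e2 \<in> hvals" "(0, 0) \<prec> e2" "h_ball X d x e2 \<subseteq> T" using T x by blast
      ultimately show "\<exists>e\<in>hvals. (0, 0) \<prec> e \<and> h_ball X d x e \<subseteq> S \<inter> T" by (rule *)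
    qed
  next
    fix \<K>
    assume K: "\<forall>K\<in>\<K>. K \<subseteq> X \<and> (\<forall>x\<in>K. \<exists>e\<in>hvals. (0, 0) \<prec> e \<and> h_ball X d x e \<subseteq> K)"
    show "\<Union>\<K> \<subseteq> X" using K by blast
    show "\<forall>x\<in>\<Union>\<K>. \<exists>e\<in>hvals. (0, 0) \<prec> e \<and> h_ball X d x e \<subseteq> \<Union>\<K>"
      using K by (meson UnionE Union_upper order_trans)
  qed
qed

lemma openin_h_topology:
  "openin (h_topology X d) U \<longleftrightarrow>
     U \<subseteq> X \<and> (\<forall>x\<in>U. \<exists>e\<in>hvals. (0, 0) \<prec> e \<and> h_ball X d x e \<subseteq> U)"
  unfolding h_topology_def topology_inverse'[OF istopology_h_topology] ..


section \<open>Hausdorff measure and Hausdorff dimension on the real line\<close>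

text \<open>
  The weight of a covering set is \<open>(diam U)\<^sup>s\<close> with \<open>0\<^sup>0 = 1\<close> for nonempty \<open>U\<close>, while the empty set has
  weight \<open>0\<close>; the case \<open>s = 0\<close> is separate because \<open>0 powr 0 = 0\<close>. With these weights the measure for
  \<open>s = 0\<close> is the counting measure and the measure for \<open>s = 1\<close> is the Lebesgue measure.
\<close>

definition hausdorff_weight :: "real \<Rightarrow> real set \<Rightarrow> ennreal" where
  "hausdorff_weight s U =
     (if U = {} then 0 else if s = 0 then 1 else ennreal (diameter U powr s))"

definition delta_covers :: "real \<Rightarrow> real set \<Rightarrow> (nat \<Rightarrow> real set) set" where
  "delta_covers \<delta> A = {U. A \<subseteq> (\<Union>i. U i) \<and> (\<forall>i. bounded (U i) \<and> diameter (U i) \<le> \<delta>)}"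

definition hausdorff_premeasure :: "real \<Rightarrow> real \<Rightarrow> real set \<Rightarrow> ennreal" where
  "hausdorff_premeasure s \<delta> A = (INF U\<in>delta_covers \<delta> A. \<Sum>i. hausdorff_weight s (U i))"

definition hausdorff_outer :: "real \<Rightarrow> real set \<Rightarrow> ennreal" where
  "hausdorff_outer s A = (SUP \<delta>\<in>{0<..}. hausdorff_premeasure s \<delta> A)"

definition hausdorff_measure :: "real \<Rightarrow> real measure" where
  "hausdorff_measure s = measure_of UNIV (sets borel) (hausdorff_outer s)"

definition hausdorff_dim :: "real set \<Rightarrow> real" where
  "hausdorff_dim A = Inf {s. 0 \<le> s \<and> hausdorff_outer s A = 0}"

text \<open>
  \<^const>\<open>measure_of\<close> yields the zero measure if its argument is not countably additive; the following
  lemmas, up to \<open>emeasure_hausdorff_measure\<close>, show that this does not happen here.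
\<close>

lemma hausdorff_weight_mono:
  assumes "U \<subseteq> V" "bounded V" "0 \<le> s"
  shows "hausdorff_weight s U \<le> hausdorff_weight s V"
  using assms diameter_subset[OF assms(1,2)] diameter_ge_0[OF bounded_subset[OF assms(2,1)]]
  by (auto simp: hausdorff_weight_def intro!: ennreal_leI powr_mono2)

lemma delta_covers_le: "\<delta> \<le> \<delta>' \<Longrightarrow> delta_covers \<delta> A \<subseteq> delta_covers \<delta>' A"
  unfolding delta_covers_def by (rule Collect_mono) (meson order_trans)

lemma hausdorff_premeasure_antimono:
  "\<delta> \<le> \<delta>' \<Longrightarrow> hausdorff_premeasure s \<delta>' A \<le> hausdorff_premeasure s \<delta> A"
  unfolding hausdorff_premeasure_def by (rule INF_superset_mono[OF delta_covers_le]) auto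

lemma hausdorff_premeasure_mono:
  "A \<subseteq> B \<Longrightarrow> hausdorff_premeasure s \<delta> A \<le> hausdorff_premeasure s \<delta> B"
  unfolding hausdorff_premeasure_def
  by (rule INF_superset_mono) (auto simp: delta_covers_def)

lemma hausdorff_premeasure_le_outer:
  "0 < \<delta> \<Longrightarrow> hausdorff_premeasure s \<delta> A \<le> hausdorff_outer s A"
  unfolding hausdorff_outer_def by (rule SUP_upper) auto

lemma hausdorff_outer_mono: "A \<subseteq> B \<Longrightarrow> hausdorff_outer s A \<le> hausdorff_outer s B"
  unfolding hausdorff_outer_def by (rule SUP_mono) (auto intro: hausdorff_premeasure_mono)

lemma hausdorff_premeasure_empty: "0 < \<delta> \<Longrightarrow> hausdorff_premeasure s \<delta> {} = 0"
proof -
  assume "0 < \<delta>"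
  then have "(\<lambda>_. {}) \<in> delta_covers \<delta> {}" by (auto simp: delta_covers_def)
  then have "hausdorff_premeasure s \<delta> {} \<le> (\<Sum>i::nat. hausdorff_weight s {})"
    unfolding hausdorff_premeasure_def by (rule INF_lower)
  then show ?thesis by (simp add: hausdorff_weight_def)
qed

lemma hausdorff_outer_empty: "hausdorff_outer s {} = 0"
  unfolding hausdorff_outer_def
  by (rule order.antisym) (auto intro!: SUP_least simp: hausdorff_premeasure_empty)

lemma hausdorff_premeasure_subadditive:
  fixes A :: "nat \<Rightarrow> real set"
  shows "hausdorff_premeasure s \<delta> (\<Union>i. A i) \<le> (\<Sum>i. hausdorff_premeasure s \<delta> (A i))"
proof (cases "(\<Sum>i. hausdorff_premeasure s \<delta> (A i)) = \<infinity>")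
  case True
  then show ?thesis by simp
next
  case False
  show ?thesis
  proof (rule ennreal_le_epsilon)
    fix e :: real assume e: "0 < e"
    have "\<exists>U\<in>delta_covers \<delta> (A i).
        (\<Sum>j. hausdorff_weight s (U j)) \<le> hausdorff_premeasure s \<delta> (A i) + ennreal (e * (1/2)^Suc i)"
      for i
    proof -
      have "hausdorff_premeasure s \<delta> (A i) \<noteq> \<infinity>"
        using False ennreal_suminf_lessD[of "\<lambda>i. hausdorff_premeasure s \<delta> (A i)" top i]
        by (auto simp: less_top)
      then have "hausdorff_premeasure s \<delta> (A i)
          < hausdorff_premeasure s \<delta> (A i) + ennreal (e * (1/2)^Suc i)"
        using ennreal_add_left_cancel_less[of "hausdorff_premeasure s \<delta> (A i)" 0
            "ennreal (e * (1/2)^Suc i)"] e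
        by simp
      then show ?thesis
        unfolding hausdorff_premeasure_def INF_less_iff by (auto intro: less_imp_le)
    qed
    then obtain U where U: "\<And>i. U i \<in> delta_covers \<delta> (A i)"
      and le: "\<And>i. (\<Sum>j. hausdorff_weight s (U i j))
        \<le> hausdorff_premeasure s \<delta> (A i) + ennreal (e * (1/2)^Suc i)"
      by metis
    define V where "V n = (case prod_decode n of (i, j) \<Rightarrow> U i j)" for n
    have "V \<in> delta_covers \<delta> (\<Union>i. A i)"
      unfolding delta_covers_def
    proof (intro CollectI conjI allI subsetI)
      fix x assume "x \<in> (\<Union>i. A i)"
      then obtain i where "x \<in> A i" by blast
      then obtain j where "x \<in> U i j" using U[of i] by (auto simp: delta_covers_def)
      then have "x \<in> V (prod_encode (i, j))" by (simp add: V_def)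
      then show "x \<in> (\<Union>i. V i)" by blast
    next
      fix n show "bounded (V n)" "diameter (V n) \<le> \<delta>"
        using U[of "fst (prod_decode n)"] by (auto simp: V_def delta_covers_def split: prod.split)
    qed
    then have "hausdorff_premeasure s \<delta> (\<Union>i. A i) \<le> (\<Sum>n. hausdorff_weight s (V n))"
      unfolding hausdorff_premeasure_def by (rule INF_lower)
    also have "\<dots> = (\<Sum>n. (\<lambda>(i, j). hausdorff_weight s (U i j)) (prod_decode n))"
      by (simp add: V_def case_prod_beta)
    also have "\<dots> = (\<Sum>i. \<Sum>j. hausdorff_weight s (U i j))"
      using suminf_ennreal_2dimen[of "\<lambda>i. \<Sum>j. hausdorff_weight s (U i j)"
          "\<lambda>(i, j). hausdorff_weight s (U i j)"] by (simp add: comp_def)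
    also have "\<dots> \<le> (\<Sum>i. hausdorff_premeasure s \<delta> (A i) + ennreal (e * (1/2)^Suc i))"
      by (intro suminf_le le) auto
    also have "\<dots> = (\<Sum>i. hausdorff_premeasure s \<delta> (A i)) + (\<Sum>i. ennreal (e * (1/2)^Suc i))"
      by (intro suminf_add[symmetric]) auto
    also have "(\<Sum>i. ennreal (e * (1/2)^Suc i)) = ennreal e"
      using e sums_mult[OF power_half_series, of e] by (intro suminf_ennreal_eq) auto
    finally show "hausdorff_premeasure s \<delta> (\<Union>i. A i)
        \<le> (\<Sum>i. hausdorff_premeasure s \<delta> (A i)) + ennreal e" .
  qed
qed

lemma hausdorff_outer_subadditive:
  fixes A :: "nat \<Rightarrow> real set"
  shows "hausdorff_outer s (\<Union>i. A i) \<le> (\<Sum>i. hausdorff_outer s (A i))"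
  unfolding hausdorff_outer_def[of s "\<Union>i. A i"]
proof (rule SUP_least)
  fix \<delta> :: real assume "\<delta> \<in> {0<..}"
  then show "hausdorff_premeasure s \<delta> (\<Union>i. A i) \<le> (\<Sum>i. hausdorff_outer s (A i))"
    by (intro order_trans[OF hausdorff_premeasure_subadditive] suminf_le
        hausdorff_premeasure_le_outer) auto
qed

lemma outer_measure_space_hausdorff: "outer_measure_space UNIV (hausdorff_outer s)"
  unfolding outer_measure_space_def positive_def increasing_def countably_subadditive_def
  by (auto simp: hausdorff_outer_empty intro: hausdorff_outer_mono hausdorff_outer_subadditive)

lemma hausdorff_outer_Un: "hausdorff_outer s (A \<union> B) \<le> hausdorff_outer s A + hausdorff_outer s B"
proof -
  define C where "C i = (if i = 0 then A else if i = 1 then B else {})" for i :: nat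
  have "A \<union> B \<subseteq> (\<Union>i. C i)"
    using UN_upper[of 0 UNIV C] UN_upper[of 1 UNIV C] by (simp add: C_def)
  then have "hausdorff_outer s (A \<union> B) \<le> (\<Sum>i. hausdorff_outer s (C i))"
    using order_trans[OF hausdorff_outer_mono hausdorff_outer_subadditive] by blast
  also have "(\<Sum>i. hausdorff_outer s (C i)) = (\<Sum>i\<in>{0, 1}. hausdorff_outer s (C i))"
    by (rule suminf_finite) (auto simp: C_def hausdorff_outer_empty)
  finally show ?thesis by (simp add: C_def)
qed

lemma hausdorff_outer_seq: "hausdorff_outer s A = (SUP n. hausdorff_premeasure s (1 / Suc n) A)"
proof (rule order.antisym)
  show "hausdorff_outer s A \<le> (SUP n. hausdorff_premeasure s (1 / Suc n) A)"
    unfolding hausdorff_outer_def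
  proof (rule SUP_least)
    fix \<delta> :: real assume "\<delta> \<in> {0<..}"
    then obtain n where "1 / Suc n < \<delta>" using nat_approx_posE[of \<delta>] by auto
    then show "hausdorff_premeasure s \<delta> A \<le> (SUP n. hausdorff_premeasure s (1 / Suc n) A)"
      by (intro SUP_upper2[of n] hausdorff_premeasure_antimono) auto
  qed
qed (auto intro!: SUP_least hausdorff_premeasure_le_outer)

lemma hausdorff_outer_separated:
  assumes "0 \<le> s" "A \<subseteq> {..a}" "B \<subseteq> {b..}" "a < b"
  shows "hausdorff_outer s A + hausdorff_outer s B \<le> hausdorff_outer s (A \<union> B)"
proof -
  have small: "hausdorff_premeasure s \<delta> A + hausdorff_premeasure s \<delta> B \<le> hausdorff_outer s (A \<union> B)"
    if \<delta>: "0 < \<delta>" "\<delta> < b - a" for \<delta>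
  proof -
    have "hausdorff_premeasure s \<delta> A + hausdorff_premeasure s \<delta> B
        \<le> (\<Sum>i. hausdorff_weight s (U i))" if U: "U \<in> delta_covers \<delta> (A \<union> B)" for U
    proof -
      have bd: "bounded (U i)" "diameter (U i) \<le> \<delta>" for i
        using U by (auto simp: delta_covers_def)
      have sub: "bounded (U i \<inter> S)" "diameter (U i \<inter> S) \<le> \<delta>" for i S
        using bd[of i] diameter_subset[of "U i \<inter> S" "U i"] bounded_subset[of "U i" "U i \<inter> S"]
        by auto
      have "(\<lambda>i. U i \<inter> {..a}) \<in> delta_covers \<delta> A" "(\<lambda>i. U i \<inter> {b..}) \<in> delta_covers \<delta> B"
        using U assms(2,3) sub by (auto simp: delta_covers_def)
      then have "hausdorff_premeasure s \<delta> A + hausdorff_premeasure s \<delta> B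
          \<le> (\<Sum>i. hausdorff_weight s (U i \<inter> {..a})) + (\<Sum>i. hausdorff_weight s (U i \<inter> {b..}))"
        unfolding hausdorff_premeasure_def by (intro add_mono INF_lower)
      also have "\<dots> = (\<Sum>i. hausdorff_weight s (U i \<inter> {..a}) + hausdorff_weight s (U i \<inter> {b..}))"
        by (intro suminf_add) auto
      also have "\<dots> \<le> (\<Sum>i. hausdorff_weight s (U i))"
      proof (intro suminf_le)
        fix i
        have "U i \<inter> {..a} = {} \<or> U i \<inter> {b..} = {}"
        proof (rule ccontr)
          assume "\<not> ?thesis"
          then obtain x y where "x \<in> U i" "x \<le> a" "y \<in> U i" "b \<le> y" by auto
          with diameter_bounded_bound[OF bd(1)[of i], of x y] bd(2)[of i] \<delta> assms(4)
          show False by (auto simp: dist_real_def)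
        qed
        then show "hausdorff_weight s (U i \<inter> {..a}) + hausdorff_weight s (U i \<inter> {b..})
            \<le> hausdorff_weight s (U i)"
          using hausdorff_weight_mono[of "U i \<inter> {..a}" "U i" s]
            hausdorff_weight_mono[of "U i \<inter> {b..}" "U i" s] bd[of i] assms(1)
          by (auto simp: hausdorff_weight_def[of s "{}"])
      qed auto
      finally show ?thesis .
    qed
    then have "hausdorff_premeasure s \<delta> A + hausdorff_premeasure s \<delta> B
        \<le> hausdorff_premeasure s \<delta> (A \<union> B)"
      unfolding hausdorff_premeasure_def[of s \<delta> "A \<union> B"] by (intro INF_greatest)
    also have "\<dots> \<le> hausdorff_outer s (A \<union> B)"
      using \<delta> by (intro hausdorff_premeasure_le_outer)
    finally show ?thesis .
  qed
  have inc: "incseq (\<lambda>n. hausdorff_premeasure s (1 / Suc n) E)" for E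
    by (intro incseq_SucI hausdorff_premeasure_antimono) (auto simp: field_simps)
  have "hausdorff_outer s A + hausdorff_outer s B
      = (SUP n. hausdorff_premeasure s (1 / Suc n) A + hausdorff_premeasure s (1 / Suc n) B)"
    unfolding hausdorff_outer_seq[of s A] hausdorff_outer_seq[of s B]
    by (rule ennreal_SUP_add[symmetric, OF inc inc])
  also have "\<dots> \<le> hausdorff_outer s (A \<union> B)"
  proof (rule SUP_least)
    fix n
    let ?\<delta> = "min (1 / Suc n) ((b - a) / 2)"
    have "hausdorff_premeasure s (1 / Suc n) A + hausdorff_premeasure s (1 / Suc n) B
        \<le> hausdorff_premeasure s ?\<delta> A + hausdorff_premeasure s ?\<delta> B"
      by (intro add_mono hausdorff_premeasure_antimono) auto
    also have "\<dots> \<le> hausdorff_outer s (A \<union> B)"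
      using assms(4) by (intro small) (auto simp: min_def field_simps)
    finally show "hausdorff_premeasure s (1 / Suc n) A + hausdorff_premeasure s (1 / Suc n) B
        \<le> hausdorff_outer s (A \<union> B)" .
  qed
  finally show ?thesis .
qed

lemma hausdorff_caratheodory_atMost:
  assumes s: "0 \<le> s"
  shows "hausdorff_outer s (x \<inter> {..a}) + hausdorff_outer s (x \<inter> {a<..}) = hausdorff_outer s x"
proof (rule order.antisym)
  have "x = (x \<inter> {..a}) \<union> (x \<inter> {a<..})" by auto
  then show "hausdorff_outer s x \<le> hausdorff_outer s (x \<inter> {..a}) + hausdorff_outer s (x \<inter> {a<..})"
    using hausdorff_outer_Un by metis
  show "hausdorff_outer s (x \<inter> {..a}) + hausdorff_outer s (x \<inter> {a<..}) \<le> hausdorff_outer s x"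
  proof (cases "hausdorff_outer s x = \<infinity>")
    case True
    then show ?thesis by simp
  next
    case False
    define E where "E n = x \<inter> {a + 1 / real (Suc n)..}" for n
    define R where "R n = x \<inter> {a + 1 / real (Suc (Suc n))..<a + 1 / real (Suc n)}" for n
    have part: "(\<Sum>k<N. hausdorff_outer s (R (2*k+c))) \<le> hausdorff_outer s (\<Union>k<N. R (2*k+c))" for N c
    proof (induction N)
      case (Suc N)
      let ?B = "\<Union>k<N. R (2*k+c)" and ?A = "R (2*N+c)"
      show ?case
      proof (cases "N = 0")
        case False
        have "?A \<subseteq> {..a + 1 / real (Suc (2*N+c))}" by (auto simp: R_def)
        moreover have "?B \<subseteq> {a + 1 / real (2*N+c)..}"
        proof (rule UN_least)
          fix k assume "k \<in> {..<N}"
          then have "1 / real (2*N+c) \<le> 1 / real (Suc (Suc (2*k+c)))"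
            by (intro divide_left_mono) auto
          then show "R (2*k+c) \<subseteq> {a + 1 / real (2*N+c)..}" by (auto simp: R_def)
        qed
        moreover have "a + 1 / real (Suc (2*N+c)) < a + 1 / real (2*N+c)"
          using False by (auto intro!: divide_strict_left_mono)
        ultimately have "hausdorff_outer s ?A + hausdorff_outer s ?B \<le> hausdorff_outer s (?A \<union> ?B)"
          using s by (intro hausdorff_outer_separated)
        moreover have "?A \<union> ?B = (\<Union>k<Suc N. R (2*k+c))" by (simp add: lessThan_Suc)
        ultimately show ?thesis using Suc.IH
          by (simp add: add.commute) (meson add_left_mono order_trans)
      qed (simp add: lessThan_Suc)
    qed (simp add: hausdorff_outer_empty)
    have half: "(\<Sum>k. hausdorff_outer s (R (2*k+c))) \<le> hausdorff_outer s x" for c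
    proof (rule suminf_le_const)
      fix N
      have "(\<Union>k<N. R (2*k+c)) \<subseteq> x" by (auto simp: R_def)
      from order_trans[OF part hausdorff_outer_mono[OF this]]
      show "(\<Sum>k<N. hausdorff_outer s (R (2*k+c))) \<le> hausdorff_outer s x" .
    qed auto
    have "(\<Sum>k. hausdorff_outer s (R k)) \<le> hausdorff_outer s x + hausdorff_outer s x"
    proof (rule suminf_le_const)
      fix N
      have "(\<Sum>k<N. hausdorff_outer s (R k)) \<le> (\<Sum>k<2*N. hausdorff_outer s (R k))"
        by (rule sum_mono2) auto
      also have "\<dots> = (\<Sum>k<N. hausdorff_outer s (R (2*k+0))) + (\<Sum>k<N. hausdorff_outer s (R (2*k+1)))"
        by (induction N) (auto simp: algebra_simps)
      also have "\<dots> \<le> hausdorff_outer s x + hausdorff_outer s x"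
        by (intro add_mono order_trans[OF sum_le_suminf half]) auto
      finally show "(\<Sum>k<N. hausdorff_outer s (R k)) \<le> hausdorff_outer s x + hausdorff_outer s x" .
    qed auto
    then have fin: "(\<Sum>k. hausdorff_outer s (R k)) \<noteq> \<infinity>"
      using False by (auto simp: top_unique)
    then have fin': "hausdorff_outer s (R k) \<noteq> \<infinity>" for k
      using ennreal_suminf_lessD[of "\<lambda>i. hausdorff_outer s (R i)" top k] by (auto simp: less_top)
    define g where "g k = enn2real (hausdorff_outer s (R k))" for k
    have g: "hausdorff_outer s (R k) = ennreal (g k)" "0 \<le> g k" for k
      using fin'[of k] by (auto simp: g_def less_top)
    have sg: "summable g"
      using fin g by (intro summable_suminf_not_top) auto
    have "hausdorff_outer s (x \<inter> {..a}) + hausdorff_outer s (x \<inter> {a<..}) \<le> hausdorff_outer s x + ennreal e"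
      if e: "0 < e" for e
    proof -
      obtain n where n: "norm (\<Sum>i. g (i + n)) < e"
        using suminf_exist_split[OF e sg] by blast
      have "x \<inter> {a<..} \<subseteq> E n \<union> (\<Union>k. R (k + n))"
      proof
        fix y assume y: "y \<in> x \<inter> {a<..}"
        show "y \<in> E n \<union> (\<Union>k. R (k + n))"
        proof (cases "y \<in> E n")
          case False
          define m where "m = (LEAST m. a + 1 / real (Suc m) \<le> y)"
          have "0 < y - a" using y by simp
          then obtain j where "1 / real (Suc j) < y - a" by (rule nat_approx_posE)
          then have ex: "\<exists>m. a + 1 / real (Suc m) \<le> y"
            by (intro exI[of _ j]) linarith
          have m: "a + 1 / real (Suc m) \<le> y"
            unfolding m_def by (rule LeastI_ex[OF ex])
          have lt: "y < a + 1 / real (Suc k)" if "k < m" for k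
            using not_less_Least[OF that[unfolded m_def]] by (simp only: not_le)
          have "n < m"
          proof (rule ccontr)
            assume "\<not> n < m"
            then have "1 / real (Suc n) \<le> 1 / real (Suc m)" by (intro divide_left_mono) auto
            with m False y show False by (auto simp: E_def)
          qed
          define k where "k = m - Suc n"
          have k: "m = Suc (k + n)" using \<open>n < m\<close> by (simp add: k_def)
          have "y < a + 1 / real (Suc (k + n))" by (rule lt) (simp add: k)
          moreover have "a + 1 / real (Suc (Suc (k + n))) \<le> y" using m unfolding k .
          ultimately have "y \<in> R (k + n)" using y by (simp add: R_def del: of_nat_Suc)
          then show ?thesis by blast
        qed simp
      qed
      then have "hausdorff_outer s (x \<inter> {a<..}) \<le> hausdorff_outer s (E n \<union> (\<Union>k. R (k + n)))"
        by (rule hausdorff_outer_mono)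
      also have "\<dots> \<le> hausdorff_outer s (E n) + hausdorff_outer s (\<Union>k. R (k + n))"
        by (rule hausdorff_outer_Un)
      finally have 0: "hausdorff_outer s (x \<inter> {a<..})
          \<le> hausdorff_outer s (E n) + hausdorff_outer s (\<Union>k. R (k + n))" .
      have "hausdorff_outer s (\<Union>k. R (k + n)) \<le> (\<Sum>k. hausdorff_outer s (R (k + n)))"
        by (rule hausdorff_outer_subadditive)
      also have "\<dots> = ennreal (\<Sum>k. g (k + n))"
        using g sg by (simp add: suminf_ennreal2 summable_iff_shift)
      also have "\<dots> \<le> ennreal e"
        using n by (intro ennreal_leI) auto
      finally have 1: "hausdorff_outer s (x \<inter> {a<..}) \<le> hausdorff_outer s (E n) + ennreal e"
        by (rule order_trans[OF 0 add_left_mono])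
      have "hausdorff_outer s (x \<inter> {..a}) + hausdorff_outer s (E n)
          \<le> hausdorff_outer s ((x \<inter> {..a}) \<union> E n)"
        using s by (intro hausdorff_outer_separated[of s _ a _ "a + 1 / real (Suc n)"]) (auto simp: E_def)
      also have "\<dots> \<le> hausdorff_outer s x"
        by (rule hausdorff_outer_mono) (auto simp: E_def)
      finally have 2: "hausdorff_outer s (x \<inter> {..a}) + hausdorff_outer s (E n) \<le> hausdorff_outer s x" .
      have "hausdorff_outer s (x \<inter> {..a}) + hausdorff_outer s (x \<inter> {a<..})
          \<le> hausdorff_outer s (x \<inter> {..a}) + (hausdorff_outer s (E n) + ennreal e)"
        by (intro add_left_mono 1)
      also have "\<dots> \<le> hausdorff_outer s x + ennreal e"
        unfolding add.assoc[symmetric] by (rule add_right_mono[OF 2])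
      finally show ?thesis .
    qed
    then show ?thesis by (rule ennreal_le_epsilon)
  qed
qed

lemma measure_space_hausdorff:
  assumes "0 \<le> s"
  shows "measure_space UNIV (sets borel) (hausdorff_outer s)"
proof -
  interpret P: sigma_algebra UNIV "UNIV :: real set set"
    using sigma_algebra_Pow[of "UNIV :: real set"] by simp
  let ?L = "lambda_system UNIV UNIV (hausdorff_outer s)"
  have L: "measure_space UNIV ?L (hausdorff_outer s)"
    by (rule P.caratheodory_lemma[OF outer_measure_space_hausdorff])
  have "{..a} \<in> ?L" for a
    using hausdorff_caratheodory_atMost[OF assms, of _ a]
    by (auto simp: P.lambda_system_eq Diff_eq)
  then have "sigma_sets UNIV (range (\<lambda>a. {..a})) \<subseteq> ?L"
    using L by (intro sigma_algebra.sigma_sets_subset) (auto simp: measure_space_def)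
  moreover have "sets borel = sigma_sets UNIV (range (\<lambda>a::real. {..a}))"
    by (subst borel_eq_atMost) (simp add: sets_measure_of)
  ultimately show ?thesis
    using sets.sigma_algebra_axioms[of "borel :: real measure"]
    by (intro measure_down[OF L]) auto
qed

lemma sets_hausdorff_measure [measurable_cong]: "sets (hausdorff_measure s) = sets borel"
  using sets.sigma_sets_eq[of "borel :: real measure"] by (simp add: hausdorff_measure_def)

lemma emeasure_hausdorff_measure:
  assumes "0 \<le> s" "A \<in> sets borel"
  shows "emeasure (hausdorff_measure s) A = hausdorff_outer s A"
  unfolding hausdorff_measure_def
  using measure_space_hausdorff[OF assms(1)] assms(2) sets.sigma_sets_eq[of "borel :: real measure"]
  by (subst emeasure_measure_of_sigma) (auto simp: measure_space_def)

text \<open>The infimum in the definition of \<^const>\<open>hausdorff_dim\<close> is over a nonempty set.\<close>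

lemma hausdorff_outer_eq_0:
  assumes s: "1 < s"
  shows "hausdorff_outer s A = 0"
proof -
  have unit: "hausdorff_premeasure s \<delta> {k..k+1} = 0" if \<delta>: "0 < \<delta>" for k \<delta>
  proof -
    have "hausdorff_premeasure s \<delta> {k..k+1} \<le> ennreal (real (Suc n) powr (1 - s))"
      if n: "1 / real (Suc n) \<le> \<delta>" for n
    proof -
      define U where "U i = (if i < Suc n then {k + real i / Suc n..k + (real i + 1) / Suc n} else {})" for i :: nat
      have dU: "diameter (U i) = (if i < Suc n then 1 / Suc n else 0)" for i
      proof -
        have "k + (real i + 1) / real (Suc n) = k + real i / real (Suc n) + 1 / real (Suc n)"
          by (simp only: add_divide_distrib add.assoc)
        then show ?thesis by (simp add: U_def del: of_nat_Suc)
      qed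
      have "{k..k+1} \<subseteq> (\<Union>i. U i)"
      proof
        fix x assume x: "x \<in> {k..k+1}"
        show "x \<in> (\<Union>i. U i)"
        proof (cases "x = k + 1")
          case True
          then have "x \<in> U n" by (simp add: U_def field_simps)
          then show ?thesis by blast
        next
          case False
          define i where "i = nat \<lfloor>(x - k) * Suc n\<rfloor>"
          have i: "real i \<le> (x - k) * Suc n" "(x - k) * Suc n < real i + 1"
            using x by (simp_all add: i_def)
          have "(x - k) * real (Suc n) < 1 * real (Suc n)"
            using x False by (intro mult_strict_right_mono) auto
          then have "real i < real (Suc n)"
            using order.strict_trans1[OF i(1)] by (simp only: mult_1)
          then have "i < Suc n" by (simp only: of_nat_less_iff)
          moreover have "i / Suc n \<le> x - k" "x - k \<le> (real i + 1) / Suc n"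
            using i by (simp_all only: pos_divide_le_eq pos_le_divide_eq of_nat_0_less_iff
                zero_less_Suc less_imp_le)
          then have "k + i / Suc n \<le> x" "x \<le> k + (real i + 1) / Suc n"
            by (simp_all only: le_diff_eq diff_le_eq add.commute)
          ultimately have "x \<in> U i" by (simp add: U_def del: of_nat_Suc)
          then show ?thesis by blast
        qed
      qed
      moreover have "bounded (U i) \<and> diameter (U i) \<le> \<delta>" for i
        using n \<delta> dU[of i] by (auto simp: U_def)
      ultimately have "hausdorff_premeasure s \<delta> {k..k+1} \<le> (\<Sum>i. hausdorff_weight s (U i))"
        unfolding hausdorff_premeasure_def by (intro INF_lower) (auto simp: delta_covers_def)
      also have "\<dots> = (\<Sum>i<Suc n. hausdorff_weight s (U i))"
        by (rule suminf_finite) (auto simp: U_def hausdorff_weight_def)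
      also have "\<dots> \<le> (\<Sum>i<Suc n. ennreal ((1 / Suc n) powr s))"
        using s by (intro sum_mono) (auto simp: hausdorff_weight_def dU)
      also have "\<dots> = ennreal (real (Suc n) * (1 / Suc n) powr s)"
        by (simp add: ennreal_mult ennreal_of_nat_eq_real_of_nat del: of_nat_Suc)
      also have "real (Suc n) * (1 / Suc n) powr s = real (Suc n) powr (1 - s)"
        by (simp add: powr_diff powr_divide del: of_nat_Suc)
      finally show ?thesis .
    qed
    moreover have "\<forall>\<^sub>F n in sequentially. 1 / real (Suc n) \<le> \<delta>"
      using order_tendstoD(2)[OF LIMSEQ_inverse_real_of_nat \<delta>]
      by eventually_elim (simp add: inverse_eq_divide)
    ultimately have "\<forall>\<^sub>F n in sequentially.
        hausdorff_premeasure s \<delta> {k..k+1} \<le> ennreal (real (Suc n) powr (1 - s))"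
      by (rule eventually_mono[rotated])
    moreover have "(\<lambda>n. real (Suc n) powr (1 - s)) \<longlonglongrightarrow> 0"
      using s by (intro tendsto_neg_powr filterlim_compose[OF filterlim_real_sequentially filterlim_Suc]) auto
    then have "(\<lambda>n. ennreal (real (Suc n) powr (1 - s))) \<longlonglongrightarrow> ennreal 0"
      by (rule tendsto_ennrealI)
    ultimately have "hausdorff_premeasure s \<delta> {k..k+1} \<le> ennreal 0"
      by (intro tendsto_lowerbound) auto
    then show ?thesis by simp
  qed
  have unit': "hausdorff_outer s {k..k+1} = 0" for k
    unfolding hausdorff_outer_def by (rule order.antisym) (auto intro!: SUP_least simp: unit)
  let ?B = "\<lambda>n. {of_int (int_decode n)..of_int (int_decode n) + 1} :: real set"
  have "x \<in> (\<Union>n. ?B n)" for x :: real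
  proof -
    have "x \<in> ?B (int_encode \<lfloor>x\<rfloor>)" by (simp add: real_of_int_floor_add_one_ge)
    then show ?thesis by blast
  qed
  then have "hausdorff_outer s A \<le> hausdorff_outer s (\<Union>n. ?B n)"
    by (intro hausdorff_outer_mono) blast
  also have "\<dots> \<le> (\<Sum>n. hausdorff_outer s (?B n))"
    by (rule hausdorff_outer_subadditive)
  finally show ?thesis by (simp add: unit')
qed

lemma hausdorff_dim_bounds: "0 \<le> hausdorff_dim A" "hausdorff_dim A \<le> 1"
proof -
  have ne: "{s. 0 \<le> s \<and> hausdorff_outer s A = 0} \<noteq> {}"
    using hausdorff_outer_eq_0[of 2 A] by (auto intro: exI[of _ 2])
  show "0 \<le> hausdorff_dim A"
    unfolding hausdorff_dim_def using ne by (intro cInf_greatest) auto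
  show "hausdorff_dim A \<le> 1"
  proof (rule dense_ge)
    fix t :: real assume "1 < t"
    then show "hausdorff_dim A \<le> t"
      unfolding hausdorff_dim_def using hausdorff_outer_eq_0[of t A]
      by (intro cInf_lower bdd_belowI[of _ 0]) auto
  qed
qed


section \<open>Hausdorff-integral\<close>

definition nonzero_set :: "real set \<Rightarrow> (real \<Rightarrow> real) \<Rightarrow> real set" where
  "nonzero_set K f = {x \<in> K. f x \<noteq> 0}"

text \<open>
  Integrals of the positive and the negative part of \<open>f\<close> over \<open>D\<^sub>f\<close>;
  \<^const>\<open>ennreal\<close> maps negative reals to \<open>0\<close>.
\<close>

definition h_int_pos :: "real set \<Rightarrow> (real \<Rightarrow> real) \<Rightarrow> ennreal" where
  "h_int_pos K f =
     (\<integral>\<^sup>+x\<in>nonzero_set K f. ennreal (f x) \<partial>hausdorff_measure (hausdorff_dim (nonzero_set K f)))"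

definition h_int_neg :: "real set \<Rightarrow> (real \<Rightarrow> real) \<Rightarrow> ennreal" where
  "h_int_neg K f =
     (\<integral>\<^sup>+x\<in>nonzero_set K f. ennreal (- f x) \<partial>hausdorff_measure (hausdorff_dim (nonzero_set K f)))"

definition hausdorff_integral_exists :: "real set \<Rightarrow> (real \<Rightarrow> real) \<Rightarrow> bool" where
  "hausdorff_integral_exists K f \<longleftrightarrow> h_int_pos K f \<noteq> \<infinity> \<or> h_int_neg K f \<noteq> \<infinity>"

definition hausdorff_integral :: "real set \<Rightarrow> (real \<Rightarrow> real) \<Rightarrow> real \<times> ereal" where
  "hausdorff_integral K f =
     (hausdorff_dim (nonzero_set K f), enn2ereal (h_int_pos K f) - enn2ereal (h_int_neg K f))"

definition hausdorff_integrable :: "real set \<Rightarrow> (real \<Rightarrow> real) \<Rightarrow> bool" where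
  "hausdorff_integrable K f \<longleftrightarrow>
     hausdorff_integral_exists K f \<and> \<bar>snd (hausdorff_integral K f)\<bar> \<noteq> \<infinity>"

text \<open>
  A function \<open>K \<rightarrow> \<real>\<close> is represented by its extension with the value \<^const>\<open>undefined\<close> outside \<open>K\<close>, so
  that equality of elements of \<open>L_H K\<close> is equality on \<open>K\<close>.
\<close>

definition L_H :: "real set \<Rightarrow> (real \<Rightarrow> real) set" where
  "L_H K = {f \<in> extensional K.
     f \<in> borel_measurable (restrict_space borel K) \<and> hausdorff_integrable K (\<lambda>x. \<bar>f x\<bar>)}"

definition h_dist :: "real set \<Rightarrow> (real \<Rightarrow> real) \<Rightarrow> (real \<Rightarrow> real) \<Rightarrow> real \<times> ereal" where
  "h_dist K f g = hausdorff_integral K (\<lambda>x. \<bar>f x - g x\<bar>)"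

end

theory Submission
  imports Defs
begin

text \<open>
  A set of dimension less than \<open>s\<close> is \<open>\<mu>\<^sup>s\<close>-null, and the dimension of a countable union is bounded by
  any common bound on the dimensions of its parts. The triangle inequality follows: the support of
  \<open>f - h\<close> lies in the union of the supports of \<open>f - g\<close> and \<open>g - h\<close>, so only the case where its
  dimension attains the larger of the two dimensions needs an estimate, and there the summand with the
  smaller dimension contributes nothing, while the usual triangle inequality for integrals does the
  rest. The distance separates points because \<open>\<mu>\<^sup>0\<close> gives every point mass at least \<open>1\<close>.

  Completeness rests on the fact that \<open>(0, \<epsilon>)\<close> is an admissible radius. A Cauchy sequence \<open>s\<close> is
  therefore, from some index on, such that all differences \<open>s n - s m\<close> have zero-dimensional support
  and small \<open>\<mu>\<^sup>0\<close>-integral, that is, a small sum of absolute values. In particular it converges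
  pointwise, to \<open>f\<close> say. The support of \<open>s n - f\<close> lies in the countable union over \<open>m\<close> of the supports
  of \<open>s n - s m\<close>, so it has dimension \<open>0\<close>, and Fatou's lemma for \<open>\<mu>\<^sup>0\<close> bounds its \<open>\<mu>\<^sup>0\<close>-integral.
  Hence \<open>s\<close> tends to \<open>f\<close>. Finally, \<open>f\<close> differs from an integrable \<open>s n\<close> by a function with
  zero-dimensional support and finite \<open>\<mu>\<^sup>0\<close>-integral, which alters neither the dimension of the
  support nor the finiteness of the integral.
\<close>

section \<open>Hausdorff dimension and null sets\<close>

text \<open>Covers by sets of diameter at most \<open>1\<close> decide the measure, and on those the weight decreases in
  the exponent.\<close>

lemma hausdorff_outer_antimono_exponent:
  assumes "0 \<le> s" "s \<le> t"
  shows "hausdorff_outer t A \<le> hausdorff_outer s A"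
  unfolding hausdorff_outer_def[of t]
proof (rule SUP_least)
  fix \<delta> :: real assume "\<delta> \<in> {0<..}"
  then have \<delta>: "0 < min \<delta> 1" by simp
  have weight: "hausdorff_weight t U \<le> hausdorff_weight s U"
    if "bounded U" "diameter U \<le> 1" for U :: "real set"
    using assms that diameter_ge_0[OF that(1)]
    by (auto simp: hausdorff_weight_def powr_le1 intro!: ennreal_leI powr_mono')
  have "hausdorff_premeasure t \<delta> A \<le> hausdorff_premeasure t (min \<delta> 1) A"
    by (rule hausdorff_premeasure_antimono) simp
  also have "\<dots> \<le> hausdorff_premeasure s (min \<delta> 1) A"
    unfolding hausdorff_premeasure_def
    by (rule INF_mono) (auto simp: delta_covers_def intro!: suminf_le weight)
  also have "\<dots> \<le> hausdorff_outer s A"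
    by (rule hausdorff_premeasure_le_outer[OF \<delta>])
  finally show "hausdorff_premeasure t \<delta> A \<le> hausdorff_outer s A" .
qed

lemma hausdorff_outer_eq_0_above_dim:
  assumes "hausdorff_dim A < s"
  shows "hausdorff_outer s A = 0"
proof -
  have "{t. 0 \<le> t \<and> hausdorff_outer t A = 0} \<noteq> {}"
    using hausdorff_outer_eq_0[of 2 A] by (auto intro: exI[of _ 2])
  then obtain t where "0 \<le> t" "hausdorff_outer t A = 0" "t < s"
    using cInf_lessD[of "{t. 0 \<le> t \<and> hausdorff_outer t A = 0}" s] assms
    by (auto simp: hausdorff_dim_def)
  then show ?thesis
    using hausdorff_outer_antimono_exponent[of t s A] by simp
qed

lemma hausdorff_dim_le:
  assumes "0 \<le> s" "\<And>t. s < t \<Longrightarrow> hausdorff_outer t A = 0"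
  shows "hausdorff_dim A \<le> s"
proof (rule dense_ge)
  fix t assume "s < t"
  then show "hausdorff_dim A \<le> t"
    unfolding hausdorff_dim_def using assms
    by (intro cInf_lower bdd_belowI[of _ 0]) auto
qed

lemma hausdorff_dim_mono:
  assumes "A \<subseteq> B"
  shows "hausdorff_dim A \<le> hausdorff_dim B"
proof (rule hausdorff_dim_le[OF hausdorff_dim_bounds(1)])
  fix t assume "hausdorff_dim B < t"
  then show "hausdorff_outer t A = 0"
    using hausdorff_outer_mono[OF assms, of t] by (simp add: hausdorff_outer_eq_0_above_dim)
qed

lemma hausdorff_dim_UN_le:
  fixes A :: "nat \<Rightarrow> real set"
  assumes "\<And>i. hausdorff_dim (A i) \<le> s"
  shows "hausdorff_dim (\<Union>i. A i) \<le> s"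
proof (rule hausdorff_dim_le)
  show "0 \<le> s" using hausdorff_dim_bounds(1)[of "A 0"] assms[of 0] by linarith
  fix t assume "s < t"
  then have "hausdorff_outer t (A i) = 0" for i
    using assms[of i] by (intro hausdorff_outer_eq_0_above_dim) linarith
  then show "hausdorff_outer t (\<Union>i. A i) = 0"
    using hausdorff_outer_subadditive[of t A] by simp
qed

lemma hausdorff_dim_Un_le:
  "hausdorff_dim (A \<union> B) \<le> max (hausdorff_dim A) (hausdorff_dim B)"
proof (rule hausdorff_dim_le)
  show "0 \<le> max (hausdorff_dim A) (hausdorff_dim B)"
    using hausdorff_dim_bounds(1)[of A] by simp
  fix t assume "max (hausdorff_dim A) (hausdorff_dim B) < t"
  then show "hausdorff_outer t (A \<union> B) = 0"
    using hausdorff_outer_Un[of t A B] by (simp add: hausdorff_outer_eq_0_above_dim)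
qed

lemma hausdorff_dim_empty: "hausdorff_dim {} = 0"
  using hausdorff_dim_le[of 0 "{}"] hausdorff_dim_bounds(1)[of "{}"]
  by (simp add: hausdorff_outer_empty)

text \<open>A cover of a nonempty set has a nonempty member, which has weight \<open>1\<close> in dimension \<open>0\<close>.\<close>

lemma hausdorff_outer_0_ge_1:
  assumes "x \<in> A"
  shows "1 \<le> hausdorff_outer 0 A"
proof -
  have "1 \<le> hausdorff_premeasure 0 1 A"
    unfolding hausdorff_premeasure_def
  proof (rule INF_greatest)
    fix U assume "U \<in> delta_covers 1 A"
    then obtain i where "x \<in> U i" using assms by (auto simp: delta_covers_def)
    then have "1 = (\<Sum>j\<in>{i}. hausdorff_weight 0 (U j))" by (auto simp: hausdorff_weight_def)
    also have "\<dots> \<le> (\<Sum>j. hausdorff_weight 0 (U j))" by (rule sum_le_suminf) auto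
    finally show "1 \<le> (\<Sum>j. hausdorff_weight 0 (U j))" .
  qed
  also have "\<dots> \<le> hausdorff_outer 0 A" by (rule hausdorff_premeasure_le_outer) simp
  finally show ?thesis .
qed

section \<open>Integrals of absolute values against Hausdorff measures\<close>

text \<open>The integral runs over \<open>K\<close> and the exponent is free. Thus functions whose supports have
  different dimensions can be compared against one and the same measure.\<close>

definition abs_integral :: "real \<Rightarrow> real set \<Rightarrow> (real \<Rightarrow> real) \<Rightarrow> ennreal" where
  "abs_integral s K u = (\<integral>\<^sup>+x\<in>K. ennreal \<bar>u x\<bar> \<partial>hausdorff_measure s)"

lemma nonzero_set_abs: "nonzero_set K (\<lambda>x. \<bar>u x\<bar>) = nonzero_set K u"
  by (simp add: nonzero_set_def)

lemma h_int_abs: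
  "h_int_pos K (\<lambda>x. \<bar>u x\<bar>) = abs_integral (hausdorff_dim (nonzero_set K u)) K u"
  "h_int_neg K (\<lambda>x. \<bar>u x\<bar>) = 0"
  unfolding h_int_pos_def h_int_neg_def abs_integral_def nonzero_set_abs
  by (auto intro!: nn_integral_cong simp: nonzero_set_def indicator_def ennreal_neg)

lemma hausdorff_integral_abs:
  "hausdorff_integral K (\<lambda>x. \<bar>u x\<bar>) =
     (hausdorff_dim (nonzero_set K u),
      enn2ereal (abs_integral (hausdorff_dim (nonzero_set K u)) K u))"
  by (simp add: hausdorff_integral_def h_int_abs nonzero_set_abs zero_ennreal.rep_eq)

lemma hausdorff_integrable_abs_iff:
  "hausdorff_integrable K (\<lambda>x. \<bar>u x\<bar>) \<longleftrightarrow>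
     abs_integral (hausdorff_dim (nonzero_set K u)) K u < \<infinity>"
  by (cases "abs_integral (hausdorff_dim (nonzero_set K u)) K u")
    (auto simp: hausdorff_integrable_def hausdorff_integral_exists_def hausdorff_integral_abs
      h_int_abs enn2ereal_ennreal)

lemma h_dist_eq:
  "h_dist K f g =
     (hausdorff_dim (nonzero_set K (\<lambda>x. f x - g x)),
      enn2ereal (abs_integral (hausdorff_dim (nonzero_set K (\<lambda>x. f x - g x))) K (\<lambda>x. f x - g x)))"
  unfolding h_dist_def by (rule hausdorff_integral_abs)

lemma h_dist_less_0:
  "h_dist K f g \<prec> (0, e) \<longleftrightarrow>
     hausdorff_dim (nonzero_set K (\<lambda>x. f x - g x)) = 0 \<and>
     enn2ereal (abs_integral 0 K (\<lambda>x. f x - g x)) < e"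
  using hausdorff_dim_bounds(1)[of "nonzero_set K (\<lambda>x. f x - g x)"]
  by (auto simp: h_dist_eq lex_less_def)

lemma h_dist_commute: "h_dist K f g = h_dist K g f"
  by (simp add: h_dist_def abs_minus_commute)

lemma nonzero_set_add_subset:
  assumes "\<And>x. x \<in> K \<Longrightarrow> w x = u x + v x"
  shows "nonzero_set K w \<subseteq> nonzero_set K u \<union> nonzero_set K v"
  using assms by (auto simp: nonzero_set_def)

lemma measurable_indicator_mult:
  fixes u :: "real \<Rightarrow> real"
  assumes "K \<in> sets borel" "u \<in> borel_measurable (restrict_space borel K)"
  shows "(\<lambda>x. indicator K x * u x) \<in> borel_measurable borel"
  using assms by (subst (asm) borel_measurable_restrict_space_iff) auto

lemma measurable_abs_indicator:
  fixes u :: "real \<Rightarrow> real"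
  assumes "K \<in> sets borel" "u \<in> borel_measurable (restrict_space borel K)"
  shows "(\<lambda>x. ennreal \<bar>u x\<bar> * indicator K x) \<in> borel_measurable (hausdorff_measure s)"
proof -
  note [measurable] = measurable_indicator_mult[OF assms]
  have "(\<lambda>x. ennreal \<bar>indicator K x * u x\<bar>) \<in> borel_measurable (hausdorff_measure s)"
    by measurable
  also have "(\<lambda>x. ennreal \<bar>indicator K x * u x\<bar>) = (\<lambda>x. ennreal \<bar>u x\<bar> * indicator K x)"
    by (auto simp: indicator_def fun_eq_iff)
  finally show ?thesis .
qed

lemma nonzero_set_borel:
  assumes "K \<in> sets borel" "u \<in> borel_measurable (restrict_space borel K)"
  shows "nonzero_set K u \<in> sets borel"
proof -
  note [measurable] = measurable_indicator_mult[OF assms]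
  have "{x \<in> space borel. indicator K x * u x \<noteq> 0} \<in> sets borel" by measurable
  also have "{x \<in> space borel. indicator K x * u x \<noteq> 0} = nonzero_set K u"
    by (auto simp: nonzero_set_def indicator_def)
  finally show ?thesis .
qed

lemma abs_integral_add_le:
  assumes "K \<in> sets borel"
    and "u \<in> borel_measurable (restrict_space borel K)" "v \<in> borel_measurable (restrict_space borel K)"
    and "\<And>x. x \<in> K \<Longrightarrow> w x = u x + v x"
  shows "abs_integral s K w \<le> abs_integral s K u + abs_integral s K v"
proof -
  have "abs_integral s K w
      \<le> (\<integral>\<^sup>+x. ennreal \<bar>u x\<bar> * indicator K x + ennreal \<bar>v x\<bar> * indicator K x \<partial>hausdorff_measure s)"
    unfolding abs_integral_def using assms(4)
    by (intro nn_integral_mono) (auto simp: indicator_def simp flip: ennreal_plus intro!: ennreal_leI)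
  also have "\<dots> = abs_integral s K u + abs_integral s K v"
    unfolding abs_integral_def
    by (intro nn_integral_add measurable_abs_indicator assms)
  finally show ?thesis .
qed

lemma abs_integral_eq_0_above_dim:
  assumes "K \<in> sets borel" "u \<in> borel_measurable (restrict_space borel K)"
    and dim: "hausdorff_dim (nonzero_set K u) < s"
  shows "abs_integral s K u = 0"
proof -
  have "0 \<le> s" using dim hausdorff_dim_bounds(1)[of "nonzero_set K u"] by linarith
  then have "nonzero_set K u \<in> null_sets (hausdorff_measure s)"
    using nonzero_set_borel[OF assms(1,2)] hausdorff_outer_eq_0_above_dim[OF dim]
    by (auto simp: null_sets_def sets_hausdorff_measure emeasure_hausdorff_measure)
  then have "AE x in hausdorff_measure s. x \<notin> nonzero_set K u" by (rule AE_not_in)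
  then have "AE x in hausdorff_measure s. ennreal \<bar>u x\<bar> * indicator K x = 0"
    by eventually_elim (auto simp: nonzero_set_def indicator_def)
  then show ?thesis
    unfolding abs_integral_def
    using measurable_abs_indicator[OF assms(1,2)] by (simp add: nn_integral_0_iff_AE)
qed

text \<open>This makes \<open>\<mu>\<^sup>0\<close>-convergence pointwise convergence: \<open>\<mu>\<^sup>0\<close> gives the point \<open>x\<close> mass at least \<open>1\<close>.\<close>

lemma abs_le_abs_integral_0:
  assumes "x \<in> K"
  shows "ennreal \<bar>u x\<bar> \<le> abs_integral 0 K u"
proof -
  have "ennreal \<bar>u x\<bar> \<le> ennreal \<bar>u x\<bar> * emeasure (hausdorff_measure 0) {x}"
    using mult_left_mono[OF hausdorff_outer_0_ge_1[of x "{x}"], of "ennreal \<bar>u x\<bar>"]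
    by (simp add: emeasure_hausdorff_measure)
  also have "\<dots> = (\<integral>\<^sup>+y. ennreal \<bar>u x\<bar> * indicator {x} y \<partial>hausdorff_measure 0)"
    by (rule nn_integral_cmult_indicator[symmetric]) (simp add: sets_hausdorff_measure)
  also have "\<dots> \<le> abs_integral 0 K u"
    unfolding abs_integral_def using assms by (intro nn_integral_mono) (auto simp: indicator_def)
  finally show ?thesis .
qed

lemma abs_integral_le_limit:
  assumes "K \<in> sets borel" "\<And>m. v m \<in> borel_measurable (restrict_space borel K)"
    and lim: "\<And>x. x \<in> K \<Longrightarrow> (\<lambda>m. v m x) \<longlonglongrightarrow> u x"
    and le: "eventually (\<lambda>m. abs_integral s K (v m) \<le> c) sequentially"
  shows "abs_integral s K u \<le> c"
proof -
  have "abs_integral s K u =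
      (\<integral>\<^sup>+x. liminf (\<lambda>m. ennreal \<bar>v m x\<bar> * indicator K x) \<partial>hausdorff_measure s)"
    unfolding abs_integral_def
  proof (rule nn_integral_cong)
    fix x
    have "(\<lambda>m. ennreal \<bar>v m x\<bar> * indicator K x) \<longlonglongrightarrow> ennreal \<bar>u x\<bar> * indicator K x"
    proof (cases "x \<in> K")
      case True
      then show ?thesis using tendsto_ennrealI[OF tendsto_rabs[OF lim[OF True]]] by simp
    qed simp
    then show "ennreal \<bar>u x\<bar> * indicator K x = liminf (\<lambda>m. ennreal \<bar>v m x\<bar> * indicator K x)"
      by (intro lim_imp_Liminf[symmetric]) auto
  qed
  also have "\<dots> \<le> liminf (\<lambda>m. abs_integral s K (v m))"
    unfolding abs_integral_def by (intro nn_integral_liminf measurable_abs_indicator assms)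
  also have "\<dots> \<le> liminf (\<lambda>m. c)" by (rule Liminf_mono[OF le])
  finally show ?thesis by (simp add: Liminf_const)
qed

section \<open>The h-metric\<close>

lemma L_H_measurable:
  "f \<in> L_H K \<Longrightarrow> f \<in> borel_measurable (restrict_space borel K)"
  by (simp add: L_H_def)

lemma L_H_diff_measurable:
  "f \<in> L_H K \<Longrightarrow> g \<in> L_H K \<Longrightarrow> (\<lambda>x. f x - g x) \<in> borel_measurable (restrict_space borel K)"
  by (auto dest!: L_H_measurable)

lemma h_dist_eq_0_iff:
  assumes "f \<in> L_H K" "g \<in> L_H K"
  shows "h_dist K f g = (0, 0) \<longleftrightarrow> f = g"
proof
  assume "f = g"
  then show "h_dist K f g = (0, 0)"
    by (simp add: h_dist_eq nonzero_set_def hausdorff_dim_empty abs_integral_def zero_ennreal.rep_eq)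
next
  assume "h_dist K f g = (0, 0)"
  then have "abs_integral 0 K (\<lambda>x. f x - g x) = 0"
    by (auto simp: h_dist_eq zero_ennreal.rep_eq simp flip: enn2ereal_inject)
  then have "f x = g x" if "x \<in> K" for x
    using abs_le_abs_integral_0[OF that, of "\<lambda>x. f x - g x"] by simp
  moreover have "f \<in> extensional K" "g \<in> extensional K" using assms by (auto simp: L_H_def)
  ultimately show "f = g" by (blast intro: extensionalityI)
qed

lemma h_dist_triangle:
  assumes K: "K \<in> sets borel" and "f \<in> L_H K" "g \<in> L_H K" "h \<in> L_H K"
  shows "h_dist K f h \<preceq> h_dist K f g +\<^sub>h h_dist K g h"
proof -
  define u v w where "u x = f x - g x" and "v x = g x - h x" and "w x = f x - h x" for x
  define a b c where "a = hausdorff_dim (nonzero_set K u)" and "b = hausdorff_dim (nonzero_set K v)"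
    and "c = hausdorff_dim (nonzero_set K w)"
  have u: "u \<in> borel_measurable (restrict_space borel K)"
    and v: "v \<in> borel_measurable (restrict_space borel K)"
    unfolding u_def[abs_def] v_def[abs_def] using assms by (auto intro!: L_H_diff_measurable)
  have w: "w x = u x + v x" for x by (simp add: u_def v_def w_def)
  have dists: "h_dist K f g = (a, enn2ereal (abs_integral a K u))"
    "h_dist K g h = (b, enn2ereal (abs_integral b K v))"
    "h_dist K f h = (c, enn2ereal (abs_integral c K w))"
    by (simp_all add: h_dist_eq a_def b_def c_def u_def[abs_def] v_def[abs_def] w_def[abs_def])
  have "c \<le> max a b"
    unfolding a_def b_def c_def
    using hausdorff_dim_mono[OF nonzero_set_add_subset] hausdorff_dim_Un_le w order_trans by metis
  then consider "c < max a b" | "c = max a b" by linarith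
  then show ?thesis
  proof cases
    case 1
    then show ?thesis by (auto simp: dists h_plus_def lex_le_def)
  next
    case 2
    have le: "abs_integral c K w \<le> abs_integral c K u + abs_integral c K v"
      by (rule abs_integral_add_le[OF K u v w])
    have "a < c \<Longrightarrow> abs_integral c K u = 0" "b < c \<Longrightarrow> abs_integral c K v = 0"
      using abs_integral_eq_0_above_dim[OF K] u v by (auto simp: a_def b_def)
    with 2 le show ?thesis
      by (auto simp: dists h_plus_def lex_le_def less_eq_ennreal.rep_eq plus_ennreal.rep_eq
          zero_ennreal.rep_eq max_def
          split: if_splits)
  qed
qed

lemma h_metric_space_L_H:
  assumes "K \<in> sets borel"
  shows "h_metric_space (L_H K) (h_dist K)"
  unfolding h_metric_space_def
proof (intro conjI ballI)
  fix f g h assume fgh: "f \<in> L_H K" "g \<in> L_H K" "h \<in> L_H K"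
  show "h_dist K f h \<preceq> h_dist K f g +\<^sub>h h_dist K g h" by (rule h_dist_triangle[OF assms fgh])
next
  fix f g assume "f \<in> L_H K" "g \<in> L_H K"
  then show "h_dist K f g = (0, 0) \<longleftrightarrow> f = g" by (rule h_dist_eq_0_iff)
next
  fix f g
  show "h_dist K f g \<in> hvals" by (simp add: h_dist_eq hvals_def hausdorff_dim_bounds)
  show "h_dist K f g = h_dist K g f" by (rule h_dist_commute)
qed

section \<open>Completeness\<close>

text \<open>Perturbing a function in \<^const>\<open>L_H\<close> on a zero-dimensional set by a \<open>\<mu>\<^sup>0\<close>-integrable amount: in
  positive dimension the perturbation is invisible to the measure, in dimension \<open>0\<close> it adds a finite
  amount.\<close>

lemma L_H_perturb:
  assumes K: "K \<in> sets borel" and g: "g \<in> L_H K"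
    and f: "f \<in> extensional K" "f \<in> borel_measurable (restrict_space borel K)"
    and dim: "hausdorff_dim (nonzero_set K (\<lambda>x. g x - f x)) = 0"
    and fin: "abs_integral 0 K (\<lambda>x. g x - f x) < \<infinity>"
  shows "f \<in> L_H K"
proof -
  define h where "h x = g x - f x" for x
  define d where "d = hausdorff_dim (nonzero_set K f)"
  have gm: "g \<in> borel_measurable (restrict_space borel K)" using g by (rule L_H_measurable)
  then have hm: "h \<in> borel_measurable (restrict_space borel K)"
    unfolding h_def[abs_def] using f(2) by (rule borel_measurable_diff)
  have h0: "hausdorff_dim (nonzero_set K h) = 0" "abs_integral 0 K h < \<infinity>"
    using dim fin by (simp_all add: h_def[abs_def])
  have sub: "nonzero_set K f \<subseteq> nonzero_set K g \<union> nonzero_set K h"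
    "nonzero_set K g \<subseteq> nonzero_set K f \<union> nonzero_set K h"
    by (auto simp: nonzero_set_def h_def)
  have d: "hausdorff_dim (nonzero_set K g) = d"
    using order_trans[OF hausdorff_dim_mono[OF sub(1)] hausdorff_dim_Un_le]
      order_trans[OF hausdorff_dim_mono[OF sub(2)] hausdorff_dim_Un_le]
      hausdorff_dim_bounds(1)[of "nonzero_set K f"] hausdorff_dim_bounds(1)[of "nonzero_set K g"]
    by (simp add: h0 d_def)
  have "abs_integral d K h < \<infinity>"
  proof (cases "d = 0")
    case False
    then have "0 < d" using hausdorff_dim_bounds(1)[of "nonzero_set K f"] by (simp add: d_def)
    then show ?thesis using abs_integral_eq_0_above_dim[OF K hm, of d] by (simp add: h0)
  qed (use h0 in simp)
  moreover have "abs_integral d K g < \<infinity>"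
    using g by (simp add: L_H_def hausdorff_integrable_abs_iff d)
  moreover have "abs_integral d K f \<le> abs_integral d K g + abs_integral d K (\<lambda>x. - h x)"
    by (rule abs_integral_add_le[OF K gm borel_measurable_uminus[OF hm]]) (simp add: h_def)
  ultimately have "abs_integral d K f < \<infinity>"
    by (auto simp: abs_integral_def intro: le_less_trans)
  then show ?thesis
    using f by (simp add: L_H_def hausdorff_integrable_abs_iff d_def)
qed

lemma h_limit_L_H:
  assumes f: "f \<in> L_H K" and s: "\<And>n. s n \<in> L_H K"
    and close: "\<And>e::real. 0 < e \<Longrightarrow>
      eventually (\<lambda>n. hausdorff_dim (nonzero_set K (\<lambda>x. s n x - f x)) = 0 \<and>
        abs_integral 0 K (\<lambda>x. s n x - f x) \<le> ennreal e) sequentially"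
  shows "limitin (h_topology (L_H K) (h_dist K)) s f sequentially"
  unfolding limitin_def
proof (intro conjI allI impI)
  let ?T = "h_topology (L_H K) (h_dist K)"
  have "openin ?T (L_H K)"
    unfolding openin_h_topology
    by (intro conjI ballI bexI[of _ "(1, 0)"]) (auto simp: h_ball_def hvals_def lex_less_def)
  then show "f \<in> topspace ?T" using f openin_subset by blast
  fix U assume "openin ?T U \<and> f \<in> U"
  then obtain e where "(0, 0) \<prec> e" "h_ball (L_H K) (h_dist K) f e \<subseteq> U"
    unfolding openin_h_topology by blast
  then obtain e1 e2 where e: "(0, 0) \<prec> (e1, e2)"
    and ball: "h_ball (L_H K) (h_dist K) f (e1, e2) \<subseteq> U"
    by (cases e) auto
  \<comment> \<open>If the first coordinate of the radius is positive, any \<open>r\<close> will do.\<close>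
  obtain r :: real where r: "0 < r" "e1 = 0 \<Longrightarrow> ereal r < e2"
  proof (cases "e1 = 0")
    case True
    then have "0 < e2" using e by (simp add: lex_less_def)
    then obtain r where "0 < ereal r" "ereal r < e2" using ereal_dense2 by blast
    then show ?thesis by (intro that[of r]) auto
  qed (use that[of 1] in simp)
  have "0 \<le> e1" using e by (auto simp: lex_less_def)
  show "eventually (\<lambda>n. s n \<in> U) sequentially"
    using close[OF r(1)]
  proof eventually_elim
    case (elim n)
    then have "enn2ereal (abs_integral 0 K (\<lambda>x. s n x - f x)) \<le> ereal r"
      using r(1) by (simp add: less_eq_ennreal.rep_eq enn2ereal_ennreal)
    then have "h_dist K f (s n) \<prec> (e1, e2)"
      using elim r(2) \<open>0 \<le> e1\<close> unfolding h_dist_commute[of K f]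
      by (cases "e1 = 0") (auto simp: h_dist_eq lex_less_def intro: le_less_trans)
    then show "s n \<in> U" using s ball by (auto simp: h_ball_def)
  qed
qed

lemma h_complete_L_H:
  assumes K: "K \<in> sets borel"
  shows "h_complete (L_H K) (h_dist K)"
  unfolding h_complete_def
proof (intro allI impI)
  fix s assume "range s \<subseteq> L_H K \<and> h_Cauchy (h_dist K) s"
  then have s: "s n \<in> L_H K" and Cauchy: "h_Cauchy (h_dist K) s" for n by auto
  have close: "\<exists>N. \<forall>n>N. \<forall>m>N. hausdorff_dim (nonzero_set K (\<lambda>x. s n x - s m x)) = 0 \<and>
      abs_integral 0 K (\<lambda>x. s n x - s m x) < ennreal e" if e: "0 < e" for e :: real
  proof -
    have "(0, ereal e) \<in> hvals" "(0, 0) \<prec> (0, ereal e)"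
      using e by (auto simp: hvals_def lex_less_def)
    then obtain N where N: "\<And>n m. n > N \<Longrightarrow> m > N \<Longrightarrow> h_dist K (s n) (s m) \<prec> (0, ereal e)"
      using Cauchy unfolding h_Cauchy_def by blast
    then show ?thesis
      using e unfolding h_dist_less_0 by (auto simp: less_ennreal.rep_eq enn2ereal_ennreal)
  qed
  have conv: "convergent (\<lambda>n. s n x)" if "x \<in> K" for x
  proof -
    have "Cauchy (\<lambda>n. s n x)"
    proof (rule metric_CauchyI)
      fix e :: real assume "0 < e"
      then obtain N where N: "\<And>n m. n > N \<Longrightarrow> m > N \<Longrightarrow>
          abs_integral 0 K (\<lambda>x. s n x - s m x) < ennreal e"
        using close by blast
      have "dist (s m x) (s n x) < e" if "m \<ge> Suc N" "n \<ge> Suc N" for m n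
      proof -
        have "ennreal \<bar>s m x - s n x\<bar> < ennreal e"
          using abs_le_abs_integral_0[OF \<open>x \<in> K\<close>, of "\<lambda>x. s m x - s n x"] N[of m n] that by auto
        then show ?thesis by (simp add: ennreal_less_iff dist_real_def)
      qed
      then show "\<exists>M. \<forall>m\<ge>M. \<forall>n\<ge>M. dist (s m x) (s n x) < e" by blast
    qed
    then show ?thesis by (rule Cauchy_convergent)
  qed
  define f where "f = restrict (\<lambda>x. lim (\<lambda>n. s n x)) K"
  have lim: "(\<lambda>n. s n x) \<longlonglongrightarrow> f x" if "x \<in> K" for x
    using conv[OF that] that by (simp add: f_def convergent_LIMSEQ_iff)
  have f: "f \<in> borel_measurable (restrict_space borel K)"
    by (rule borel_measurable_LIMSEQ_real[of _ s])
      (auto simp: space_restrict_space intro: lim L_H_measurable s)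
  have near: "\<exists>N. \<forall>n>N. hausdorff_dim (nonzero_set K (\<lambda>x. s n x - f x)) = 0 \<and>
      abs_integral 0 K (\<lambda>x. s n x - f x) \<le> ennreal e" if e: "0 < e" for e :: real
  proof -
    obtain N where N: "\<And>n m. n > N \<Longrightarrow> m > N \<Longrightarrow>
        hausdorff_dim (nonzero_set K (\<lambda>x. s n x - s m x)) = 0"
      "\<And>n m. n > N \<Longrightarrow> m > N \<Longrightarrow> abs_integral 0 K (\<lambda>x. s n x - s m x) < ennreal e"
      using close[OF e] by blast
    have "hausdorff_dim (nonzero_set K (\<lambda>x. s n x - f x)) = 0 \<and>
      abs_integral 0 K (\<lambda>x. s n x - f x) \<le> ennreal e" if n: "n > N" for n
    proof
      define v where "v m x = s n x - s (m + Suc N) x" for m x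
      have lim_v: "(\<lambda>m. v m x) \<longlonglongrightarrow> s n x - f x" if "x \<in> K" for x
        unfolding v_def
        by (intro tendsto_diff tendsto_const LIMSEQ_ignore_initial_segment[OF lim[OF that]])
      have "nonzero_set K (\<lambda>x. s n x - f x) \<subseteq> (\<Union>m. nonzero_set K (v m))"
      proof (rule subsetI, rule ccontr)
        fix x assume x: "x \<in> nonzero_set K (\<lambda>x. s n x - f x)" "x \<notin> (\<Union>m. nonzero_set K (v m))"
        then have "x \<in> K" "\<And>m. v m x = 0" by (auto simp: nonzero_set_def)
        then have "(\<lambda>_. 0) \<longlonglongrightarrow> s n x - f x" using lim_v[of x] by simp
        then have "s n x - f x = 0" by (simp add: LIMSEQ_const_iff)
        with x show False by (simp add: nonzero_set_def)
      qed
      moreover have "hausdorff_dim (\<Union>m. nonzero_set K (v m)) \<le> 0"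
        using N(1)[OF n] by (intro hausdorff_dim_UN_le) (simp add: v_def[abs_def])
      ultimately show "hausdorff_dim (nonzero_set K (\<lambda>x. s n x - f x)) = 0"
        using hausdorff_dim_mono hausdorff_dim_bounds(1) by (meson order.antisym order_trans)
      have v: "v m \<in> borel_measurable (restrict_space borel K)" for m
        unfolding v_def[abs_def] by (intro L_H_diff_measurable s)
      have "abs_integral 0 K (v m) \<le> ennreal e" for m
        using N(2)[OF n, of "m + Suc N"] by (simp add: v_def[abs_def])
      then show "abs_integral 0 K (\<lambda>x. s n x - f x) \<le> ennreal e"
        by (intro abs_integral_le_limit[of K v, OF K v lim_v]) auto
    qed
    then show ?thesis by blast
  qed
  have "f \<in> L_H K"
  proof -
    obtain N where "\<forall>n>N. hausdorff_dim (nonzero_set K (\<lambda>x. s n x - f x)) = 0 \<and>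
        abs_integral 0 K (\<lambda>x. s n x - f x) \<le> ennreal 1"
      using near[of 1] by auto
    then have "hausdorff_dim (nonzero_set K (\<lambda>x. s (Suc N) x - f x)) = 0"
      "abs_integral 0 K (\<lambda>x. s (Suc N) x - f x) \<le> ennreal 1"
      by blast+
    then show ?thesis
      by (intro L_H_perturb[OF K s _ f]) (auto simp: f_def intro: le_less_trans)
  qed
  moreover have "limitin (h_topology (L_H K) (h_dist K)) s f sequentially"
    using near by (intro h_limit_L_H[OF \<open>f \<in> L_H K\<close> s]) (simp add: eventually_at_top_dense)
  ultimately show "\<exists>f\<in>L_H K. limitin (h_topology (L_H K) (h_dist K)) s f sequentially" by blast
qed

theorem theorem3p14:
  fixes K :: "real set"
  assumes "K \<in> sets borel"
  shows "h_metric_space (L_H K) (h_dist K) \<and> h_complete (L_H K) (h_dist K)"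
  using h_metric_space_L_H[OF assms] h_complete_L_H[OF assms] ..

end
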